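(* Let $\{S_k\}_{k\in\mathbb{Z}_+}$ be the NUCC (non-uniform corner-cutting) scheme. Then $\{S_k\}$ is stable and convergent (that is, $C^0$).
   Context: Notation. $\mathbb{Z}_+$ is the set of nonnegative integers. A (linear) non-uniform subdivision scheme $\{S_k:k\in\mathbb{Z}_+\}$ with finitely supported masks $\mathbf{a}^{j,k}=\{\mathbf{a}^{j,k}_n:n\in\mathbb{Z}\}$ acts on real sequences $\mathbf{g}=\{\mathbf{g}_j:j\in\mathbb{Z}\}$ by $$(S_k\mathbf{g})_{2j+\nu}=\sum_{i\in\mathbb{Z}}\mathbf{a}^{j,k}_{2i+\nu}\,\mathbf{g}_{j-i},\qquad \nu=0,1,\ j\in\mathbb{Z}.$$ The grid points are $t^k_j:=2^{-k}(j-\tfrac12)$ (dual parametrization). $S_{\mathbf a}$ denotes the classical (stationary, uniform) corner-cutting scheme, i.e. the scheme with mask $\mathbf{a}_{-2}=\tfrac14,\ \mathbf{a}_{-1}=\mathbf{a}_0=\tfrac34,\ \mathbf{a}_1=\tfrac14$ (other entries zero) for all $j,k$. The NUCC scheme. Given real initial data $\mathbf{f}^0=\{\mathbf{f}^0_j:j\in\mathbb{Z}\}$, put $\mathbf{d}^0_j:=\mathbf{f}^0_{j-1}-2\mathbf{f}^0_j+\mathbf{f}^0_{j+1}$ and $\mathbf{d}^k:=S_{\mathbf a}^k\mathbf{d}^0$. The operators $S_k$ and data $\mathbf{f}^{k+1}:=S_k\mathbf{f}^k$ are built recursively: for $j\in\mathbb{Z}$, $\nu\in\{0,1\}$, let $$\gamma_{2j+\nu}=\gamma_{2j+\nu,k}:=\sqrt{\frac{\mathbf{d}^k_{j+\nu}}{\mathbf{f}^k_{j+\nu}+\epsilon}}$$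 (real or purely imaginary), where $\epsilon$ is a nonzero number with $|\epsilon|$ a fixed positive constant and whose sign is that of $\mathbf{f}^k_{j+\nu}$ (either sign if $\mathbf{f}^k_{j+\nu}=0$). The only nonzero entries of the mask $\mathbf{a}^{j,k}$ are $$\mathbf{a}^{j,k}_{-2}=\frac{\sinh(\frac14\gamma_{2j}2^{-k})}{\sinh(\gamma_{2j}2^{-k})},\quad \mathbf{a}^{j,k}_{-1}=\frac{\sinh(\frac34\gamma_{2j+1}2^{-k})}{\sinh(\gamma_{2j+1}2^{-k})},\quad \mathbf{a}^{j,k}_{0}=\frac{\sinh(\frac34\gamma_{2j}2^{-k})}{\sinh(\gamma_{2j}2^{-k})},\quad \mathbf{a}^{j,k}_{1}=\frac{\sinh(\frac14\gamma_{2j+1}2^{-k})}{\sinh(\gamma_{2j+1}2^{-k})},$$ where for $\gamma=0$ the quotients are replaced by their limits $\tfrac14,\tfrac34$. Once $\mathbf{f}^0$ is fixed, the masks are fixed, and $\{S_k\}$ is regarded as a sequence of linear operators. Standing assumptions. The shape parameters $\gamma_{2j+\nu,k}$ are uniformly bounded in $j,\nu,k$, and $\mathbf{a}_n-\tfrac14<\mathbf{a}^{j,k}_n<\mathbf{a}_n+\tfrac14$ for all $j,k$ and $n\in\{-2,-1,0,1\}$. Definitions. A scheme $\{S_k\}$ is stable if there is $C>0$ such that $\sup_{k,n\in\mathbb{Z}_+}\|S_{k+n}\cdots S_k\mathbf{g}\|_\infty\le C\|\mathbf{g}\|_\infty$ for all $\mathbf{g}\in\ell^\infty(\mathbb{Z})$.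 It is convergent if for any initial data $\mathbf{g}^0$, with $\mathbf{g}^{k}:=S_{k-1}\cdots S_0\mathbf{g}^0$, there is $g\in C(\mathbb{R})$ such that for every compact $\Omega\subset\mathbb{R}$, $\lim_{k\to\infty}\sup_{j\in\mathbb{Z}\cap 2^k\Omega}|\mathbf{g}^k_j-g(t^k_j)|=0$, and $g\not\equiv0$ for some $\mathbf{g}^0$. *)

theory Defs
  imports "HOL-Analysis.Analysis"
begin

definition linf_norm :: "(int \<Rightarrow> real) \<Rightarrow> ennreal" where
  "linf_norm g = (SUP j. ennreal \<bar>g j\<bar>)"

text \<open>One step of a linear non-uniform subdivision scheme. The argument \<open>a j n\<close> is the mask entry
  $a^{j}_n$; the output index is written $m = 2j + \nu$ with $\nu \in \{0,1\}$. The sum over all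
  integers $i$ is restricted to the (finite) support of the mask.\<close>

definition subdiv_op :: "(int \<Rightarrow> int \<Rightarrow> real) \<Rightarrow> (int \<Rightarrow> real) \<Rightarrow> int \<Rightarrow> real" where
  "subdiv_op a g m =
     (let j = m div 2; \<nu> = m mod 2
      in \<Sum>i | a j (2 * i + \<nu>) \<noteq> 0. a j (2 * i + \<nu>) * g (j - i))"

text \<open>\<open>subdiv_iter S k n\<close> is the product $S_{k+n-1} \cdots S_k$ of \<open>n\<close> operators.\<close>

primrec subdiv_iter ::
  "(nat \<Rightarrow> (int \<Rightarrow> real) \<Rightarrow> int \<Rightarrow> real) \<Rightarrow> nat \<Rightarrow> nat \<Rightarrow> (int \<Rightarrow> real) \<Rightarrow> int \<Rightarrow> real" where
  "subdiv_iter S k 0 g = g"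
| "subdiv_iter S k (Suc n) g = S (k + n) (subdiv_iter S k n g)"

definition stable_scheme :: "(nat \<Rightarrow> (int \<Rightarrow> real) \<Rightarrow> int \<Rightarrow> real) \<Rightarrow> bool" where
  "stable_scheme S \<longleftrightarrow>
     (\<exists>C>0::real. \<forall>g. linf_norm g < top \<longrightarrow>
        (SUP (k, n). linf_norm (subdiv_iter S k (Suc n) g)) \<le> ennreal C * linf_norm g)"

definition dual_grid :: "nat \<Rightarrow> int \<Rightarrow> real" where
  "dual_grid k j = (real_of_int j - 1 / 2) / 2 ^ k"

text \<open>The supremum is taken in \<open>ennreal\<close>, so that it is 0 if no integer lies in $2^k\Omega$.\<close>

definition scheme_limit ::
  "(nat \<Rightarrow> (int \<Rightarrow> real) \<Rightarrow> int \<Rightarrow> real) \<Rightarrow> (int \<Rightarrow> real) \<Rightarrow> (real \<Rightarrow> real) \<Rightarrow> bool" where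
  "scheme_limit S g0 g \<longleftrightarrow>
     continuous_on UNIV g \<and>
     (\<forall>\<Omega>. compact \<Omega> \<longrightarrow>
        (\<lambda>k. SUP j \<in> {j. real_of_int j \<in> (\<lambda>x. 2 ^ k * x) ` \<Omega>}.
               ennreal \<bar>subdiv_iter S 0 k g0 j - g (dual_grid k j)\<bar>) \<longlonglongrightarrow> 0)"

definition convergent_scheme :: "(nat \<Rightarrow> (int \<Rightarrow> real) \<Rightarrow> int \<Rightarrow> real) \<Rightarrow> bool" where
  "convergent_scheme S \<longleftrightarrow>
     (\<forall>g0. \<exists>g. scheme_limit S g0 g) \<and>
     (\<exists>g0 g. scheme_limit S g0 g \<and> (\<exists>x. g x \<noteq> 0))"

definition cc_mask :: "int \<Rightarrow> real" where
  "cc_mask n =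
     (if n = -2 then 1/4 else if n = -1 then 3/4
      else if n = 0 then 3/4 else if n = 1 then 1/4 else 0)"

definition cc_op :: "(int \<Rightarrow> real) \<Rightarrow> int \<Rightarrow> real" where
  "cc_op = subdiv_op (\<lambda>j. cc_mask)"

definition nucc_diff :: "(int \<Rightarrow> real) \<Rightarrow> nat \<Rightarrow> int \<Rightarrow> real" where
  "nucc_diff f0 k = (cc_op ^^ k) (\<lambda>j. f0 (j - 1) - 2 * f0 j + f0 (j + 1))"

text \<open>The shape parameter $\gamma_m$, $m = 2j+\nu$, of one level, from the data \<open>d\<close>, \<open>f\<close> and
  the values \<open>\<epsilon>\<close> of that level; $j + \nu$ is \<open>m div 2 + m mod 2\<close>.\<close>

definition gamma_of :: "(int \<Rightarrow> real) \<Rightarrow> (int \<Rightarrow> real) \<Rightarrow> (int \<Rightarrow> real) \<Rightarrow> int \<Rightarrow> complex" where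
  "gamma_of d f \<epsilon> m =
     (let i = m div 2 + m mod 2 in csqrt (complex_of_real (d i / (f i + \<epsilon> m))))"

text \<open>For $z$ real or purely imaginary the quotient $\sinh(cz)/\sinh(z)$ is real, so \<open>Re\<close> only
  changes the type; \<open>c\<close> is the limit for $z \to 0$. If $z$ is a nonzero multiple of $\pi i$,
  the quotient is undefined in the mathematics and 0 here; this violates the strict lower bounds on
  the mask entries that are assumed for the scheme.\<close>

definition sinh_ratio :: "real \<Rightarrow> complex \<Rightarrow> real" where
  "sinh_ratio c z = (if z = 0 then c else Re (sinh (of_real c * z) / sinh z))"

definition mask_of :: "nat \<Rightarrow> (int \<Rightarrow> complex) \<Rightarrow> int \<Rightarrow> int \<Rightarrow> real" where
  "mask_of k \<gamma> j n =
     (if n = -2 then sinh_ratio (1/4) (\<gamma> (2 * j) / 2 ^ k)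
      else if n = -1 then sinh_ratio (3/4) (\<gamma> (2 * j + 1) / 2 ^ k)
      else if n = 0 then sinh_ratio (3/4) (\<gamma> (2 * j) / 2 ^ k)
      else if n = 1 then sinh_ratio (1/4) (\<gamma> (2 * j + 1) / 2 ^ k)
      else 0)"

text \<open>Below, \<open>eps k m\<close> is the number $\epsilon$ that enters $\gamma_{m,k}$; its sign depends on the
  data and is constrained where these constants are used.\<close>

primrec nucc_data :: "(nat \<Rightarrow> int \<Rightarrow> real) \<Rightarrow> (int \<Rightarrow> real) \<Rightarrow> nat \<Rightarrow> int \<Rightarrow> real" where
  "nucc_data eps f0 0 = f0"
| "nucc_data eps f0 (Suc k) =
     subdiv_op (mask_of k (gamma_of (nucc_diff f0 k) (nucc_data eps f0 k) (eps k)))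
       (nucc_data eps f0 k)"

definition nucc_gamma :: "(nat \<Rightarrow> int \<Rightarrow> real) \<Rightarrow> (int \<Rightarrow> real) \<Rightarrow> nat \<Rightarrow> int \<Rightarrow> complex" where
  "nucc_gamma eps f0 k = gamma_of (nucc_diff f0 k) (nucc_data eps f0 k) (eps k)"

definition nucc_mask :: "(nat \<Rightarrow> int \<Rightarrow> real) \<Rightarrow> (int \<Rightarrow> real) \<Rightarrow> nat \<Rightarrow> int \<Rightarrow> int \<Rightarrow> real" where
  "nucc_mask eps f0 k = mask_of k (nucc_gamma eps f0 k)"

definition nucc_scheme ::
  "(nat \<Rightarrow> int \<Rightarrow> real) \<Rightarrow> (int \<Rightarrow> real) \<Rightarrow> nat \<Rightarrow> (int \<Rightarrow> real) \<Rightarrow> int \<Rightarrow> real" where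
  "nucc_scheme eps f0 k = subdiv_op (nucc_mask eps f0 k)"

end

theory Submission
  imports Defs
begin

text \<open>The scheme is asymptotically equivalent to corner cutting. With bounded shape parameters the
  argument \<open>\<gamma> 2^{-k}\<close> of the quotients \<open>sinh (c z) / sinh z\<close> tends to 0 like \<open>2^{-k}\<close>, and the quotient
  differs from its value \<open>c\<close> at 0 only by \<open>O(z^2)\<close>. Hence all mask entries of level \<open>k\<close> are within
  \<open>K/4^k\<close> of those of corner cutting (\<open>sinh_ratio_scaled\<close>). The rest concerns any sequence of masks
  with this property (locale \<open>cc_perturbation\<close>), however the masks have come about.

  Corner cutting forms convex combinations of two neighbours, so it enlarges no bound; the
  perturbed step of level \<open>k\<close> multiplies a bound by at most \<open>1 + 2K/4^k\<close>. The product of these factors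
  converges, which gives stability (\<open>iter_bound\<close>, \<open>stable\<close>).

  Corner cutting also halves the largest difference of neighbours, and the summable perturbation
  does not spoil the rate: the differences of level \<open>k\<close> are \<open>O(2^{-k})\<close> (\<open>diff_decay\<close>). The values of
  level \<open>k + 1\<close> are near those of level \<open>k\<close> at the same place, up to a multiple of the differences of
  level \<open>k\<close> and of \<open>K/4^k\<close>. So the iterates, viewed as step functions, form a locally uniform Cauchy
  sequence whose jumps tend to 0, and the limit is continuous (\<open>scheme_limit\<close>).

  Finally, the strict bounds on the mask entries make them positive with row sums above \<open>1/2\<close>.
  Starting from the constant 1, finitely many steps therefore keep the data away from 0, and the
  convergent product of the factors \<open>1 - 2K/4^k\<close> does so for all later steps
  (\<open>iter_one_lower_bound\<close>).\<close>

section \<open>Two-point refinement rules\<close>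

lemma subdiv_op_two_point:
  assumes "\<And>n. n \<notin> {-2, -1, 0, 1} \<Longrightarrow> a (m div 2) n = 0"
  shows "subdiv_op a g m =
    a (m div 2) (m mod 2) * g (m div 2) + a (m div 2) (m mod 2 - 2) * g (m div 2 + 1)"
proof -
  define j where "j = m div 2"
  define \<nu> where "\<nu> = m mod 2"
  have nu: "\<nu> = 0 \<or> \<nu> = 1" unfolding \<nu>_def by presburger
  have sub: "{i. a j (2 * i + \<nu>) \<noteq> 0} \<subseteq> {-1, 0}"
  proof
    fix i assume "i \<in> {i. a j (2 * i + \<nu>) \<noteq> 0}"
    with assms[of "2 * i + \<nu>"] have "2 * i + \<nu> \<in> {-2, -1, 0, 1}" unfolding j_def by blast
    with nu show "i \<in> {-1, 0}" by auto
  qed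
  have "subdiv_op a g m = (\<Sum>i | a j (2 * i + \<nu>) \<noteq> 0. a j (2 * i + \<nu>) * g (j - i))"
    by (simp add: subdiv_op_def Let_def j_def \<nu>_def)
  also have "\<dots> = (\<Sum>i\<in>{-1, 0}. a j (2 * i + \<nu>) * g (j - i))"
    by (rule sum.mono_neutral_left) (use sub in auto)
  finally show ?thesis by (simp add: j_def \<nu>_def)
qed

lemma cc_op_two_point:
  "cc_op g m = cc_mask (m mod 2) * g (m div 2) + cc_mask (m mod 2 - 2) * g (m div 2 + 1)"
  unfolding cc_op_def by (rule subdiv_op_two_point) (auto simp: cc_mask_def)

lemma cc_op_even: "cc_op g (2 * i) = 3/4 * g i + 1/4 * g (i + 1)"
  by (simp add: cc_op_two_point cc_mask_def)

lemma cc_op_odd: "cc_op g (2 * i + 1) = 1/4 * g i + 3/4 * g (i + 1)"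
  by (simp add: cc_op_two_point cc_mask_def)

lemma cc_op_bound:
  assumes "\<bar>g (m div 2)\<bar> \<le> M" "\<bar>g (m div 2 + 1)\<bar> \<le> M"
  shows "\<bar>cc_op g m\<bar> \<le> M"
proof -
  have "m = 2 * (m div 2) \<or> m = 2 * (m div 2) + 1" by presburger
  then show ?thesis
    using assms cc_op_even[of g "m div 2"] cc_op_odd[of g "m div 2"] by (auto; linarith)
qed

text \<open>Corner cutting halves the largest difference: the two new points on an edge are half an
  edge apart, and the two new points next to a vertex differ by a quarter of the sum of the adjacent edges.\<close>

lemma cc_op_diff_even: "cc_op g (2 * i + 1) - cc_op g (2 * i) = (g (i + 1) - g i) / 2"
  unfolding cc_op_even cc_op_odd by (simp add: field_simps)

lemma cc_op_diff_odd:
  "cc_op g (2 * i + 2) - cc_op g (2 * i + 1) = ((g (i + 2) - g (i + 1)) + (g (i + 1) - g i)) / 4"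
  using cc_op_even[of g "i + 1"] cc_op_odd[of g i] by (simp add: field_simps)

text \<open>The windows localise the iteration: a new value at \<open>m\<close> depends on the old values at
  \<open>m div 2\<close> and \<open>m div 2 + 1\<close>, so the values of level \<open>n\<close> in a window depend only on the initial
  values in the window of level 0. In parameter space every window covers \<open>[-N, N]\<close>. This is what
  makes unbounded initial data admissible.\<close>

definition window :: "nat \<Rightarrow> nat \<Rightarrow> int set" where
  "window N n = {- (int N * 2 ^ n) .. int N * 2 ^ n + 1}"

lemma window_parents:
  assumes "m \<in> window N (Suc n)"
  shows "m div 2 \<in> window N n" "m div 2 + 1 \<in> window N n"
proof -
  define L where "L = int N * 2 ^ n"
  have "- (2 * L) \<le> m" "m \<le> 2 * L + 1"
    using assms by (auto simp: window_def L_def)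
  then have "- L \<le> m div 2" "m div 2 \<le> L" by presburger+
  then show "m div 2 \<in> window N n" "m div 2 + 1 \<in> window N n"
    by (auto simp: window_def L_def)
qed

lemma ex_window: "\<exists>N. j \<in> window N n"
proof
  have "\<bar>j\<bar> * 1 \<le> \<bar>j\<bar> * 2 ^ n" by (intro mult_left_mono) auto
  then have "\<bar>j\<bar> \<le> int (nat \<bar>j\<bar>) * 2 ^ n" by simp
  then show "j \<in> window (nat \<bar>j\<bar>) n" unfolding window_def atLeastAtMost_iff by linarith
qed

section \<open>Perturbed corner cutting\<close>

locale cc_perturbation =
  fixes a :: "nat \<Rightarrow> int \<Rightarrow> int \<Rightarrow> real" and K :: real
  assumes support: "\<And>k j n. n \<notin> {-2, -1, 0, 1} \<Longrightarrow> a k j n = 0"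
    and close: "\<And>k j n. \<bar>a k j n - cc_mask n\<bar> \<le> K / 4 ^ k"
begin

abbreviation S :: "nat \<Rightarrow> (int \<Rightarrow> real) \<Rightarrow> int \<Rightarrow> real" where
  "S k \<equiv> subdiv_op (a k)"

lemma K_nonneg: "0 \<le> K"
  using close[of 0 0 0] by (smt (verit) div_by_1 power_0)

lemma step_two_point:
  "S k g m = a k (m div 2) (m mod 2) * g (m div 2)
    + a k (m div 2) (m mod 2 - 2) * g (m div 2 + 1)"
  by (rule subdiv_op_two_point) (rule support)

lemma step_deviation:
  assumes "\<bar>g (m div 2)\<bar> \<le> M" "\<bar>g (m div 2 + 1)\<bar> \<le> M"
  shows "\<bar>S k g m - cc_op g m\<bar> \<le> 2 * K / 4 ^ k * M"
proof -
  have *: "\<bar>(a k j n - cc_mask n) * x\<bar> \<le> K / 4 ^ k * M" if "\<bar>x\<bar> \<le> M" for j n x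
    unfolding abs_mult using close[of k j n] that by (intro mult_mono) auto
  have "S k g m - cc_op g m
      = (a k (m div 2) (m mod 2) - cc_mask (m mod 2)) * g (m div 2)
      + (a k (m div 2) (m mod 2 - 2) - cc_mask (m mod 2 - 2)) * g (m div 2 + 1)"
    by (simp add: step_two_point cc_op_two_point algebra_simps)
  then show ?thesis
    using *[OF assms(1), of "m div 2" "m mod 2"] *[OF assms(2), of "m div 2" "m mod 2 - 2"]
    by linarith
qed

text \<open>One step enlarges a bound at most by the factor \<open>1 + 2K/4^k \<le> exp (2K/4^k)\<close>. The exponent
  \<open>4K(1 - 1/2^n)\<close> dominates the sum of the increments and never exceeds \<open>4K\<close>, so the bound is
  uniform in the number of steps and in the starting level.\<close>

lemma iter_bound:
  assumes g: "\<And>j. j \<in> window N 0 \<Longrightarrow> \<bar>g j\<bar> \<le> M" and M: "0 \<le> M"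
    and j: "j \<in> window N n"
  shows "\<bar>subdiv_iter S k n g j\<bar> \<le> exp (4 * K) * M"
proof -
  have "\<bar>subdiv_iter S k n g j\<bar> \<le> exp (4 * K * (1 - 1 / 2 ^ n)) * M"
    using j
  proof (induction n arbitrary: j)
    case 0
    then show ?case using g by simp
  next
    case (Suc n)
    define h where "h = subdiv_iter S k n g"
    define B where "B = exp (4 * K * (1 - 1 / 2 ^ n)) * M"
    have h: "\<bar>h (j div 2)\<bar> \<le> B" "\<bar>h (j div 2 + 1)\<bar> \<le> B"
      unfolding h_def B_def using Suc.IH window_parents[OF Suc.prems] by blast+
    have B: "0 \<le> B" using M by (simp add: B_def)
    have "(2::real) ^ n \<le> 4 ^ n * 4 ^ k"
      using mult_mono[of "(2::real) ^ n" "4 ^ n" 1 "4 ^ k"] by (simp add: power_mono)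
    then have "2 * K / 4 ^ (k + n) \<le> 2 * K / 2 ^ n"
      using K_nonneg by (intro divide_left_mono) (auto simp: power_add mult.commute)
    then have "1 + 2 * K / 4 ^ (k + n) \<le> exp (2 * K / 2 ^ n)"
      using exp_ge_add_one_self[of "2 * K / 2 ^ n"] by linarith
    then have "(1 + 2 * K / 4 ^ (k + n)) * B \<le> exp (2 * K / 2 ^ n) * B"
      using B by (rule mult_right_mono)
    also have "\<dots> = exp (4 * K * (1 - 1 / 2 ^ Suc n)) * M"
      unfolding B_def mult.assoc[symmetric] exp_add[symmetric] by (simp add: field_simps)
    finally have "(1 + 2 * K / 4 ^ (k + n)) * B \<le> exp (4 * K * (1 - 1 / 2 ^ Suc n)) * M" .
    moreover have "\<bar>S (k + n) h j\<bar> \<le> (1 + 2 * K / 4 ^ (k + n)) * B"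
      using step_deviation[of h j B "k + n", OF h] cc_op_bound[of h j B, OF h]
      by (simp add: algebra_simps)
    ultimately show ?case by (simp add: h_def)
  qed
  also have "\<dots> \<le> exp (4 * K) * M"
    using K_nonneg M by (intro mult_right_mono) (auto simp: field_simps)
  finally show ?thesis .
qed

theorem stable: "stable_scheme S"
  unfolding stable_scheme_def
proof (intro exI[of _ "exp (4 * K)"] conjI allI impI)
  fix g assume "linf_norm g < top"
  then obtain M where M: "0 \<le> M" "linf_norm g = ennreal M"
    by (cases "linf_norm g") (auto simp: top_unique)
  have g: "\<bar>g j\<bar> \<le> M" for j
  proof -
    have "ennreal \<bar>g j\<bar> \<le> ennreal M"
      unfolding M(2)[symmetric] linf_norm_def by (rule SUP_upper) simp
    then show ?thesis using M(1) by simp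
  qed
  have "linf_norm (subdiv_iter S k (Suc n) g) \<le> ennreal (exp (4 * K) * M)" for k n
    unfolding linf_norm_def
  proof (rule SUP_least)
    fix j
    obtain N where "j \<in> window N (Suc n)" using ex_window by blast
    then show "ennreal \<bar>subdiv_iter S k (Suc n) g j\<bar> \<le> ennreal (exp (4 * K) * M)"
      using iter_bound g M(1) by (intro ennreal_leI) blast
  qed
  then show "(SUP (k, n). linf_norm (subdiv_iter S k (Suc n) g)) \<le> ennreal (exp (4 * K)) * linf_norm g"
    unfolding M(2) using M(1) by (auto simp: ennreal_mult intro!: SUP_least)
qed simp

section \<open>Decay of differences\<close>

text \<open>Multiplied by \<open>2^k\<close>, the largest difference at level \<open>k\<close> grows from one level to the next by
  at most \<open>8KM/2^k\<close>: corner cutting halves it, and the perturbation contributes twice the deviation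
  of one step. These increments are summable.\<close>

lemma diff_decay:
  assumes bd: "\<And>k j. j \<in> window N k \<Longrightarrow> \<bar>subdiv_iter S 0 k g j\<bar> \<le> M"
    and "j \<in> window N k" "j + 1 \<in> window N k"
  shows "\<bar>subdiv_iter S 0 k g (j + 1) - subdiv_iter S 0 k g j\<bar> \<le> (2 * M + 16 * K * M) / 2 ^ k"
proof -
  have M: "0 \<le> M" using bd[OF assms(2)] by linarith
  have "\<bar>subdiv_iter S 0 k g (j + 1) - subdiv_iter S 0 k g j\<bar>
      \<le> (2 * M + 16 * K * M * (1 - 1 / 2 ^ k)) / 2 ^ k"
    using assms(2,3)
  proof (induction k arbitrary: j)
    case 0
    then show ?case using bd[of j 0] bd[of "j + 1" 0] by simp
  next
    case (Suc k)
    define h where "h = subdiv_iter S 0 k g"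
    define D where "D = (2 * M + 16 * K * M * (1 - 1 / 2 ^ k)) / 2 ^ k"
    have IH: "\<bar>h (i + 1) - h i\<bar> \<le> D" if "i \<in> window N k" "i + 1 \<in> window N k" for i
      unfolding h_def D_def using Suc.IH that by blast
    have dev: "\<bar>S k h m - cc_op h m\<bar> \<le> 2 * K / 4 ^ k * M" if "m \<in> window N (Suc k)" for m
      using window_parents[OF that] bd by (intro step_deviation) (auto simp: h_def)
    have "\<bar>cc_op h (j + 1) - cc_op h j\<bar> \<le> D / 2"
    proof (cases "even j")
      case True
      then obtain i where i: "j = 2 * i" by (auto elim: evenE)
      have "\<bar>h (i + 1) - h i\<bar> \<le> D"
        using window_parents[OF Suc.prems(1)] i by (intro IH) auto
      then show ?thesis using cc_op_diff_even[of h i] i by (simp add: abs_if split: if_splits)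
    next
      case False
      then obtain i where i: "j = 2 * i + 1" by (auto elim: oddE)
      have w: "i \<in> window N k" "i + 1 \<in> window N k" "i + 2 \<in> window N k"
        using window_parents[OF Suc.prems(1)] window_parents[OF Suc.prems(2)] i
        by (auto simp: add.commute)
      have "\<bar>h (i + 1) - h i\<bar> \<le> D" "\<bar>h (i + 2) - h (i + 1)\<bar> \<le> D"
        using IH[OF w(1,2)] IH[of "i + 1"] w by (auto simp: add.assoc)
      then have "\<bar>(h (i + 2) - h (i + 1)) + (h (i + 1) - h i)\<bar> \<le> 2 * D"
        by (intro order_trans[OF abs_triangle_ineq]) simp
      moreover have "j + 1 = 2 * i + 2" using i by simp
      ultimately show ?thesis
        unfolding \<open>j + 1 = 2 * i + 2\<close> unfolding i cc_op_diff_odd by simp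
    qed
    then have "\<bar>S k h (j + 1) - S k h j\<bar> \<le> D / 2 + 2 * (2 * K / 4 ^ k * M)"
      using dev[OF Suc.prems(1)] dev[OF Suc.prems(2)] by linarith
    also have "\<dots> = (2 * M + 16 * K * M * (1 - 1 / 2 ^ Suc k)) / 2 ^ Suc k"
    proof -
      have "(4::real) ^ k = 2 ^ k * 2 ^ k" by (simp flip: power_mult_distrib)
      then show ?thesis unfolding D_def by (simp add: field_simps)
    qed
    finally show ?case by (simp add: h_def)
  qed
  also have "\<dots> \<le> (2 * M + 16 * K * M) / 2 ^ k"
    using K_nonneg M by (intro divide_right_mono) (auto simp: algebra_simps)
  finally show ?thesis .
qed

end

section \<open>The limit function\<close>

text \<open>The iterates are viewed as step functions: at level \<open>k\<close> the line is cut into cells of length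
  \<open>1/2^k\<close> whose midpoints are the points of the dual grid. Cells are then nested, and refinement
  replaces cell \<open>c\<close> by the cells \<open>2c - 1\<close> and \<open>2c\<close>.\<close>

definition cell :: "nat \<Rightarrow> real \<Rightarrow> int" where
  "cell k x = \<lfloor>2 ^ k * x\<rfloor> + 1"

lemma cell_dual_grid: "cell k (dual_grid k j) = j"
proof -
  have "\<lfloor>real_of_int j - 1 / 2\<rfloor> = j - 1" by (rule floor_unique) auto
  then show ?thesis by (simp add: cell_def dual_grid_def)
qed

lemma cell_Suc: "cell (Suc k) x = 2 * cell k x - 1 \<or> cell (Suc k) x = 2 * cell k x"
proof -
  define y where "y = 2 ^ k * x"
  have "2 * y < 2 * real_of_int \<lfloor>y\<rfloor> + 2" by linarith
  then have "2 * \<lfloor>y\<rfloor> \<le> \<lfloor>2 * y\<rfloor>" "\<lfloor>2 * y\<rfloor> < 2 * \<lfloor>y\<rfloor> + 2"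
    by (simp_all add: le_floor_iff floor_less_iff)
  then have "\<lfloor>2 * y\<rfloor> = 2 * \<lfloor>y\<rfloor> \<or> \<lfloor>2 * y\<rfloor> = 2 * \<lfloor>y\<rfloor> + 1" by presburger
  then show ?thesis by (auto simp: cell_def y_def mult.assoc)
qed

lemma cell_in_window:
  assumes "\<bar>x\<bar> \<le> real N"
  shows "cell k x \<in> window N k"
proof -
  define y where "y = 2 ^ k * x"
  define L where "L = int N * 2 ^ k"
  have "\<bar>y\<bar> = \<bar>x\<bar> * 2 ^ k" by (simp add: y_def abs_mult)
  also have "\<dots> \<le> real N * 2 ^ k" using assms by (intro mult_right_mono) auto
  also have "\<dots> = real_of_int L" by (simp add: L_def)
  finally have "- L \<le> \<lfloor>y\<rfloor>" "\<lfloor>y\<rfloor> \<le> L" by linarith+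
  then show ?thesis by (simp add: cell_def window_def y_def L_def)
qed

lemma cell_adjacent:
  assumes "x \<le> y" "y < x + 1 / 2 ^ k"
  shows "cell k y = cell k x \<or> cell k y = cell k x + 1"
proof -
  have "2 ^ k * y < 2 ^ k * (x + 1 / 2 ^ k)" using assms(2) by (intro mult_strict_left_mono) auto
  then have "2 ^ k * y < 2 ^ k * x + 1" by (simp add: distrib_left)
  moreover have "2 ^ k * x \<le> 2 ^ k * y" using assms(1) by simp
  ultimately show ?thesis unfolding cell_def by linarith
qed

text \<open>A sequence with geometrically decaying increments stays within twice the current increment
  bound of its limit.\<close>

lemma geometric_increments_limit:
  fixes u :: "nat \<Rightarrow> real"
  assumes inc: "\<And>k. \<bar>u (Suc k) - u k\<bar> \<le> E / 2 ^ k"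
  shows "convergent u" "\<bar>u k - lim u\<bar> \<le> 2 * E / 2 ^ k"
proof -
  have E: "0 \<le> E" using inc[of 0] by simp
  have near: "\<bar>u (k + n) - u k\<bar> \<le> 2 * E / 2 ^ k * (1 - 1 / 2 ^ n)" for k n
  proof (induction n)
    case (Suc n)
    have "\<bar>u (k + Suc n) - u k\<bar> \<le> E / 2 ^ (k + n) + 2 * E / 2 ^ k * (1 - 1 / 2 ^ n)"
      using Suc.IH inc[of "k + n"] by simp
    also have "\<dots> = 2 * E / 2 ^ k * (1 - 1 / 2 ^ Suc n)" by (simp add: field_simps power_add)
    finally show ?case .
  qed simp
  have near': "\<bar>u m - u k\<bar> \<le> 2 * E / 2 ^ k" if "k \<le> m" for k m
  proof -
    have "\<bar>u m - u k\<bar> \<le> 2 * E / 2 ^ k * (1 - 1 / 2 ^ (m - k))" using near[of k "m - k"] that by simp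
    also have "\<dots> \<le> 2 * E / 2 ^ k * 1" using E by (intro mult_left_mono) auto
    finally show ?thesis by simp
  qed
  have lim0: "(\<lambda>k. 2 * E / 2 ^ k) \<longlonglongrightarrow> 0"
    using tendsto_mult_right_zero[OF LIMSEQ_power_zero[of "1 / 2 :: real"], of "2 * E"]
    by (simp add: power_one_over)
  have "Cauchy u"
    unfolding Cauchy_altdef2 dist_real_def
  proof (intro allI impI)
    fix e :: real assume "e > 0"
    then have "\<forall>\<^sub>F k in sequentially. 2 * E / 2 ^ k < e" using order_tendstoD(2)[OF lim0] by blast
    then obtain k where "2 * E / 2 ^ k < e" by (auto simp: eventually_sequentially)
    then show "\<exists>M. \<forall>m\<ge>M. \<bar>u m - u M\<bar> < e" using near' by (meson le_less_trans)
  qed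
  then show c: "convergent u" by (simp add: Cauchy_convergent_iff)
  then have "u \<longlonglongrightarrow> lim u" by (simp add: convergent_LIMSEQ_iff)
  then have "(\<lambda>m. \<bar>u m - u k\<bar>) \<longlonglongrightarrow> \<bar>lim u - u k\<bar>" by (intro tendsto_intros)
  then have "\<bar>lim u - u k\<bar> \<le> 2 * E / 2 ^ k"
    by (rule LIMSEQ_le_const2) (use near' in blast)
  then show "\<bar>u k - lim u\<bar> \<le> 2 * E / 2 ^ k" by (simp add: abs_minus_commute)
qed

context cc_perturbation
begin

definition step_fun :: "(int \<Rightarrow> real) \<Rightarrow> nat \<Rightarrow> real \<Rightarrow> real" where
  "step_fun g k x = subdiv_iter S 0 k g (cell k x)"

definition limit_fun :: "(int \<Rightarrow> real) \<Rightarrow> real \<Rightarrow> real" where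
  "limit_fun g x = lim (\<lambda>k. step_fun g k x)"

text \<open>Points less than a cell length apart lie in the same or in adjacent cells, so the first estimate
  is the decay of differences. For the second, both new points that fall into a cell are cut from
  its old point towards a neighbour, by a quarter of the edge. The constants depend on the
  window because the initial data may be unbounded.\<close>

lemma step_fun_estimates:
  obtains D E where
    "\<And>k x y. \<lbrakk>\<bar>x\<bar> \<le> real N; \<bar>y\<bar> \<le> real N; \<bar>x - y\<bar> < 1 / 2 ^ k\<rbrakk>
       \<Longrightarrow> \<bar>step_fun g k x - step_fun g k y\<bar> \<le> D / 2 ^ k"
    "\<And>k x. \<bar>x\<bar> \<le> real N \<Longrightarrow> \<bar>step_fun g (Suc k) x - step_fun g k x\<bar> \<le> E / 2 ^ k"
proof -
  define M0 where "M0 = (\<Sum>j\<in>window N 0. \<bar>g j\<bar>)"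
  define M where "M = exp (4 * K) * M0"
  have fin: "finite (window N 0)" by (simp add: window_def)
  have M0: "\<bar>g j\<bar> \<le> M0" if "j \<in> window N 0" for j
    unfolding M0_def using fin that by (intro member_le_sum) auto
  have M0': "0 \<le> M0" unfolding M0_def by (rule sum_nonneg) simp
  then have M: "0 \<le> M" by (simp add: M_def)
  have bd: "\<bar>subdiv_iter S 0 k g j\<bar> \<le> M" if "j \<in> window N k" for k j
    unfolding M_def using iter_bound[OF M0 M0' that] .
  define D where "D = 2 * M + 16 * K * M"
  have D: "0 \<le> D" using M K_nonneg by (simp add: D_def)
  have diff: "\<bar>subdiv_iter S 0 k g (j + 1) - subdiv_iter S 0 k g j\<bar> \<le> D / 2 ^ k"
    if "j \<in> window N k" "j + 1 \<in> window N k" for j k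
    unfolding D_def using diff_decay[OF bd that] .
  have ordered: "\<bar>step_fun g k y - step_fun g k x\<bar> \<le> D / 2 ^ k"
    if "\<bar>x\<bar> \<le> real N" "\<bar>y\<bar> \<le> real N" "x \<le> y" "y < x + 1 / 2 ^ k" for k x y
    using cell_adjacent[OF that(3,4)] diff[of "cell k x" k] D
      cell_in_window[OF that(1), of k] cell_in_window[OF that(2), of k]
    by (auto simp: step_fun_def)
  have "\<bar>step_fun g k x - step_fun g k y\<bar> \<le> D / 2 ^ k"
    if "\<bar>x\<bar> \<le> real N" "\<bar>y\<bar> \<le> real N" "\<bar>x - y\<bar> < 1 / 2 ^ k" for k x y
    using ordered[of x y k] ordered[of y x k] that by (cases "x \<le> y") (auto simp: abs_minus_commute)
  moreover have "\<bar>step_fun g (Suc k) x - step_fun g k x\<bar> \<le> (D + 2 * K * M) / 2 ^ k"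
    if x: "\<bar>x\<bar> \<le> real N" for k x
  proof -
    define h where "h = subdiv_iter S 0 k g"
    define c where "c = cell k x"
    define m where "m = cell (Suc k) x"
    have m: "m = 2 * (c - 1) + 1 \<or> m = 2 * c" using cell_Suc[of k x] by (auto simp: c_def m_def)
    have mw: "m \<in> window N (Suc k)" unfolding m_def by (rule cell_in_window[OF x])
    note w = window_parents[OF mw]
    have "\<bar>h (m div 2)\<bar> \<le> M" "\<bar>h (m div 2 + 1)\<bar> \<le> M" using bd w by (auto simp: h_def)
    note dev = step_deviation[OF this, of k]
    have "\<bar>h (m div 2 + 1) - h (m div 2)\<bar> \<le> D / 2 ^ k" unfolding h_def by (rule diff[OF w])
    moreover have "\<bar>cc_op h m - h c\<bar> = \<bar>h (m div 2 + 1) - h (m div 2)\<bar> / 4"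
      using m
    proof
      assume e: "m = 2 * (c - 1) + 1"
      have "m div 2 = c - 1" using e by presburger
      moreover have "cc_op h m = 1/4 * h (c - 1) + 3/4 * h c"
        using cc_op_odd[of h "c - 1"] e by simp
      ultimately show ?thesis by (simp add: abs_if)
    next
      assume e: "m = 2 * c"
      then have "cc_op h m = 3/4 * h c + 1/4 * h (c + 1)" by (simp add: cc_op_even)
      then show ?thesis by (simp add: e abs_if)
    qed
    moreover have "0 \<le> D / 2 ^ k" using D by simp
    ultimately have "\<bar>cc_op h m - h c\<bar> \<le> D / 2 ^ k" by simp
    then have "\<bar>S k h m - h c\<bar> \<le> D / 2 ^ k + 2 * K / 4 ^ k * M"
      using dev unfolding abs_le_iff by linarith
    also have "2 * K / 4 ^ k * M \<le> 2 * K / 2 ^ k * M"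
      using K_nonneg M by (intro mult_right_mono divide_left_mono) (auto simp: power_mono)
    finally show ?thesis by (simp add: step_fun_def h_def c_def m_def add_divide_distrib)
  qed
  ultimately show thesis using that by blast
qed

text \<open>On \<open>[-N, N]\<close> the step functions converge geometrically, and their jumps decay at the same
  rate. So the uniform limit has no jumps.\<close>

lemma continuous_limit_fun: "continuous_on UNIV (limit_fun g)"
  unfolding continuous_on_iff dist_real_def
proof (intro ballI allI impI)
  fix x e :: real assume e: "0 < e"
  obtain N where "\<bar>x\<bar> + 1 \<le> real N" using real_arch_simple by blast
  obtain D E where
    D: "\<And>k x y. \<lbrakk>\<bar>x\<bar> \<le> real N; \<bar>y\<bar> \<le> real N; \<bar>x - y\<bar> < 1 / 2 ^ k\<rbrakk>
       \<Longrightarrow> \<bar>step_fun g k x - step_fun g k y\<bar> \<le> D / 2 ^ k" and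
    E: "\<And>k x. \<bar>x\<bar> \<le> real N \<Longrightarrow> \<bar>step_fun g (Suc k) x - step_fun g k x\<bar> \<le> E / 2 ^ k"
    using step_fun_estimates[of N g] by blast
  have "(\<lambda>k. (4 * E + D) * (1 / 2) ^ k) \<longlonglongrightarrow> 0"
    by (intro tendsto_mult_right_zero LIMSEQ_power_zero) simp
  then have "\<forall>\<^sub>F k in sequentially. (4 * E + D) * (1 / 2) ^ k < e"
    using e by (rule order_tendstoD(2))
  then obtain k where k: "(4 * E + D) / 2 ^ k < e"
    by (auto simp: eventually_sequentially power_one_over)
  show "\<exists>d>0. \<forall>y\<in>UNIV. \<bar>y - x\<bar> < d \<longrightarrow> \<bar>limit_fun g y - limit_fun g x\<bar> < e"
  proof (intro exI[of _ "1 / 2 ^ k"] conjI ballI impI)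
    fix y assume y: "\<bar>y - x\<bar> < 1 / 2 ^ k"
    have "1 / 2 ^ k \<le> (1::real)" by simp
    then have xN: "\<bar>x\<bar> \<le> real N" and yN: "\<bar>y\<bar> \<le> real N"
      using \<open>\<bar>x\<bar> + 1 \<le> real N\<close> y by linarith+
    have "\<bar>step_fun g k z - limit_fun g z\<bar> \<le> 2 * E / 2 ^ k" if "\<bar>z\<bar> \<le> real N" for z
      unfolding limit_fun_def
      by (rule geometric_increments_limit(2)[where u = "\<lambda>k. step_fun g k z"]) (rule E[OF that])
    from this[OF xN] this[OF yN] D[OF yN xN y]
    have "\<bar>limit_fun g y - limit_fun g x\<bar> \<le> (4 * E + D) / 2 ^ k"
      by (simp add: add_divide_distrib)
    then show "\<bar>limit_fun g y - limit_fun g x\<bar> < e" using k by linarith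
  qed simp
qed

theorem scheme_limit: "scheme_limit S g (limit_fun g)"
  unfolding scheme_limit_def
proof (intro conjI allI impI)
  show "continuous_on UNIV (limit_fun g)" by (rule continuous_limit_fun)
next
  fix \<Omega> :: "real set" assume "compact \<Omega>"
  then have "bounded \<Omega>" by (rule compact_imp_bounded)
  then obtain R where R: "\<And>x. x \<in> \<Omega> \<Longrightarrow> \<bar>x\<bar> \<le> R"
    by (auto simp: bounded_iff)
  obtain N where N: "R + 1 \<le> real N" using real_arch_simple by blast
  obtain E where
    E: "\<And>k x. \<bar>x\<bar> \<le> real N \<Longrightarrow> \<bar>step_fun g (Suc k) x - step_fun g k x\<bar> \<le> E / 2 ^ k"
    by (rule step_fun_estimates[of N g]) (rule that)
  have est: "\<bar>subdiv_iter S 0 k g j - limit_fun g (dual_grid k j)\<bar> \<le> 2 * E / 2 ^ k"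
    if j: "real_of_int j \<in> (\<lambda>x. 2 ^ k * x) ` \<Omega>" for k j
  proof -
    obtain x where x: "x \<in> \<Omega>" "real_of_int j = 2 ^ k * x" using j by auto
    have "dual_grid k j = x - 1 / 2 / 2 ^ k" using x(2) by (simp add: dual_grid_def field_simps)
    moreover have "1 / 2 / 2 ^ k \<le> 1 / 2 / (1::real)"
      by (intro divide_left_mono) auto
    moreover have "(0::real) \<le> 1 / 2 / 2 ^ k" by simp
    ultimately have "\<bar>dual_grid k j\<bar> \<le> real N" using R[OF x(1)] N by linarith
    then have "\<bar>step_fun g k (dual_grid k j) - limit_fun g (dual_grid k j)\<bar> \<le> 2 * E / 2 ^ k"
      unfolding limit_fun_def
      by (intro geometric_increments_limit(2)[where u = "\<lambda>k. step_fun g k (dual_grid n j)" for n]) 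
        (rule E)
    then show ?thesis by (simp add: step_fun_def cell_dual_grid)
  qed
  have lim0: "(\<lambda>k. ennreal (2 * E / 2 ^ k)) \<longlonglongrightarrow> 0"
  proof -
    have "(\<lambda>k. 2 * E * (1 / 2) ^ k) \<longlonglongrightarrow> 0"
      by (intro tendsto_mult_right_zero LIMSEQ_power_zero) simp
    then have "(\<lambda>k. ennreal (2 * E * (1 / 2) ^ k)) \<longlonglongrightarrow> ennreal 0" by (rule tendsto_ennrealI)
    then show ?thesis by (simp add: power_one_over)
  qed
  show "(\<lambda>k. SUP j \<in> {j. real_of_int j \<in> (\<lambda>x. 2 ^ k * x) ` \<Omega>}.
      ennreal \<bar>subdiv_iter S 0 k g j - limit_fun g (dual_grid k j)\<bar>) \<longlonglongrightarrow> 0"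
  proof (rule tendsto_sandwich[OF _ _ tendsto_const lim0])
    show "\<forall>\<^sub>F k in sequentially. (SUP j \<in> {j. real_of_int j \<in> (\<lambda>x. 2 ^ k * x) ` \<Omega>}.
      ennreal \<bar>subdiv_iter S 0 k g j - limit_fun g (dual_grid k j)\<bar>) \<le> ennreal (2 * E / 2 ^ k)"
      using est by (intro always_eventually allI SUP_least ennreal_leI) auto
  qed simp
qed

section \<open>A limit that does not vanish\<close>

text \<open>The nearness of the masks to corner cutting is only asymptotic, so the first few steps have to
  be controlled separately: there, nonnegative masks with row sums at least \<open>1/2\<close> keep
  constant data positive. From level \<open>k0\<close> on, the factor \<open>1 - 2K/4^k\<close> that a step can cost is
  compensated by the decrease of the weight \<open>1 + 1/2^k\<close>, which stays above 1.\<close>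

lemma iter_one_lower_bound:
  assumes pos: "\<And>k j n. n \<in> {-2, -1, 0, 1} \<Longrightarrow> 0 \<le> a k j n"
    and rows: "\<And>k j. 1 / 2 \<le> a k j 0 + a k j (-2)" "\<And>k j. 1 / 2 \<le> a k j 1 + a k j (-1)"
  shows "\<exists>c>0. \<forall>k j. c \<le> subdiv_iter S 0 k (\<lambda>_. 1) j"
proof -
  define it where "it k = subdiv_iter S 0 k (\<lambda>_. 1)" for k
  have step: "max (1 / 2) (1 - 2 * K / 4 ^ k) * c \<le> it (Suc k) m"
    if c: "0 \<le> c" "\<And>j. c \<le> it k j" for k c m
  proof -
    define p where "p = a k (m div 2) (m mod 2)"
    define q where "q = a k (m div 2) (m mod 2 - 2)"
    have "m mod 2 = 0 \<or> m mod 2 = 1" by presburger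
    then have pq: "0 \<le> p" "0 \<le> q" "1 / 2 \<le> p + q" "cc_mask (m mod 2) + cc_mask (m mod 2 - 2) = 1"
      using pos rows by (auto simp: p_def q_def cc_mask_def)
    have "1 - 2 * K / 4 ^ k \<le> p + q"
      using close[of k "m div 2" "m mod 2"] close[of k "m div 2" "m mod 2 - 2"] pq(4)
      unfolding p_def q_def by (simp add: abs_le_iff)
    then have "max (1 / 2) (1 - 2 * K / 4 ^ k) * c \<le> (p + q) * c"
      using pq(3) c(1) by (intro mult_right_mono) auto
    also have "\<dots> \<le> p * it k (m div 2) + q * it k (m div 2 + 1)"
      unfolding distrib_right using pq c by (intro add_mono mult_left_mono) auto
    also have "\<dots> = it (Suc k) m" by (simp add: it_def step_two_point p_def q_def)
    finally show ?thesis .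
  qed
  have half: "(1 / 2) ^ k \<le> it k j" for k j
  proof (induction k arbitrary: j)
    case 0
    then show ?case by (simp add: it_def)
  next
    case (Suc k)
    have "(1 / 2) ^ Suc k \<le> max (1 / 2) (1 - 2 * K / 4 ^ k) * (1 / 2) ^ k"
      unfolding power_Suc by (rule mult_right_mono) auto
    also have "\<dots> \<le> it (Suc k) j" using Suc.IH by (intro step) auto
    finally show ?case .
  qed
  \<comment> \<open>With \<open>x = 1/2^k\<close> and \<open>k \<ge> k0\<close>, this makes the loss \<open>2 K x^2 (1 + x)\<close> at most the drop \<open>x/2\<close> of the weight.\<close>
  obtain k0 where k0: "8 * K < 2 ^ k0" using real_arch_pow[of 2 "8 * K"] by auto
  \<comment> \<open>Half of the lower bound after \<open>k0\<close> steps, because the weight can be as large as 2.\<close>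
  define c where "c = (1 / 2 :: real) ^ Suc k0"
  have c: "0 < c" by (simp add: c_def)
  have late: "c * (1 + 1 / 2 ^ (k0 + n)) \<le> it (k0 + n) j" for n j
  proof (induction n arbitrary: j)
    case 0
    have "c * (1 + 1 / 2 ^ k0) \<le> c * 2" using c by (intro mult_left_mono) auto
    also have "\<dots> \<le> it k0 j" using half[of k0 j] by (simp add: c_def)
    finally show ?case by simp
  next
    case (Suc n)
    define x where "x = (1 / 2 :: real) ^ (k0 + n)"
    have x: "0 < x" "x \<le> 1" unfolding x_def by (auto simp: power_le_one)
    have "(2::real) ^ k0 \<le> 2 ^ (k0 + n)" by simp
    then have "8 * K \<le> 2 ^ (k0 + n)" using k0 by linarith
    then have Kx: "8 * K * x \<le> 1" by (simp add: x_def power_one_over field_simps)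
    have four: "(4::real) ^ (k0 + n) = 2 ^ (k0 + n) * 2 ^ (k0 + n)"
      by (simp flip: power_mult_distrib)
    have "2 * K * x * x * (1 + x) \<le> 2 * K * x * x * 2"
      using x K_nonneg by (intro mult_left_mono) auto
    also have "\<dots> = 8 * K * x * (x / 2)" by simp
    also have "\<dots> \<le> 1 * (x / 2)" using Kx x by (intro mult_right_mono) auto
    finally have "1 + x / 2 \<le> (1 - 2 * K * x * x) * (1 + x)" by (simp add: algebra_simps)
    then have "c * (1 + x / 2) \<le> (1 - 2 * K * x * x) * (c * (1 + x))"
      using c by (metis mult.left_commute mult_le_cancel_left_pos)
    also have "\<dots> = (1 - 2 * K / 4 ^ (k0 + n)) * (c * (1 + x))"
      by (simp add: x_def four power_one_over)
    also have "\<dots> \<le> max (1 / 2) (1 - 2 * K / 4 ^ (k0 + n)) * (c * (1 + x))"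
      using c x by (intro mult_right_mono) auto
    also have "\<dots> \<le> it (Suc (k0 + n)) j"
      using Suc.IH c x by (intro step) (auto simp: x_def power_one_over)
    finally show ?case by (simp add: x_def power_one_over mult.commute)
  qed
  have "c \<le> it k j" for k j
  proof (cases "k \<le> k0")
    case True
    have "c \<le> (1 / 2) ^ k" unfolding c_def using True by (intro power_decreasing) auto
    then show ?thesis using half[of k j] by linarith
  next
    case False
    have "c \<le> c * (1 + 1 / 2 ^ k)" using c by (simp add: algebra_simps)
    then show ?thesis using late[of "k - k0" j] False by simp
  qed
  then show ?thesis using c unfolding it_def by blast
qed

theorem convergent:
  assumes "\<And>k j n. n \<in> {-2, -1, 0, 1} \<Longrightarrow> 0 \<le> a k j n"
    and "\<And>k j. 1 / 2 \<le> a k j 0 + a k j (-2)" "\<And>k j. 1 / 2 \<le> a k j 1 + a k j (-1)"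
  shows "convergent_scheme S"
proof -
  obtain c where c: "c > 0" "\<And>k j. c \<le> subdiv_iter S 0 k (\<lambda>_. 1) j"
    using iter_one_lower_bound[OF assms] by blast
  have "c \<le> limit_fun (\<lambda>_. 1) 0"
  proof -
    obtain E where
      "\<And>k x. \<bar>x\<bar> \<le> real 0 \<Longrightarrow> \<bar>step_fun (\<lambda>_. 1) (Suc k) x - step_fun (\<lambda>_. 1) k x\<bar> \<le> E / 2 ^ k"
      by (rule step_fun_estimates[of 0 "\<lambda>_. 1"]) (rule that)
    then have "convergent (\<lambda>k. step_fun (\<lambda>_. 1) k 0)"
      using geometric_increments_limit(1)[of "\<lambda>k. step_fun (\<lambda>_. 1) k 0" E] by auto
    then have "(\<lambda>k. step_fun (\<lambda>_. 1) k 0) \<longlonglongrightarrow> limit_fun (\<lambda>_. 1) 0"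
      by (simp add: convergent_LIMSEQ_iff limit_fun_def)
    then show ?thesis
      by (rule LIMSEQ_le_const) (use c(2) in \<open>auto simp: step_fun_def\<close>)
  qed
  then have "limit_fun (\<lambda>_. 1) 0 \<noteq> 0" using c(1) by linarith
  then show ?thesis unfolding convergent_scheme_def using scheme_limit by blast
qed

end

section \<open>The masks of the NUCC scheme\<close>

text \<open>The quadratic Taylor terms of \<open>exp w\<close> and \<open>exp (- w)\<close> cancel in the difference, so only the cubic
  remainders are left. The constant comes from \<open>exp 1 \<le> 3\<close>.\<close>

lemma sinh_near_identity:
  fixes w :: complex
  assumes "norm w \<le> 1"
  shows "norm (sinh w - w) \<le> 3 / 2 * norm w ^ 3"
proof -
  have T: "norm (exp v - (1 + v + v\<^sup>2 / 2)) \<le> 3 / 2 * norm w ^ 3" if "v = w \<or> v = - w" for v :: complex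
  proof -
    have v: "norm v = norm w" using that by auto
    have "norm (exp v - (\<Sum>i\<le>2. v ^ i / fact i)) \<le> exp \<bar>Re v\<bar> * norm v ^ Suc 2 / fact 2"
      by (rule Taylor_exp)
    moreover have "(\<Sum>i\<le>2. v ^ i / fact i) = 1 + v + v\<^sup>2 / 2"
      by (simp add: numeral_2_eq_2)
    moreover have "exp \<bar>Re v\<bar> * norm v ^ Suc 2 / fact 2 \<le> 3 * norm v ^ Suc 2 / fact 2"
    proof -
      have "exp \<bar>Re v\<bar> \<le> exp 1" using abs_Re_le_cmod[of v] v assms by simp
      also have "\<dots> \<le> (3::real)" by (rule exp_le)
      finally show ?thesis by (intro divide_right_mono mult_right_mono) auto
    qed
    ultimately show ?thesis by (simp add: v)
  qed
  have "sinh w - w = ((exp w - (1 + w + w\<^sup>2 / 2)) - (exp (- w) - (1 + (- w) + (- w)\<^sup>2 / 2))) / 2"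
    by (simp add: sinh_field_def field_simps)
  also have "norm \<dots> \<le> (norm (exp w - (1 + w + w\<^sup>2 / 2)) + norm (exp (- w) - (1 + (- w) + (- w)\<^sup>2 / 2))) / 2"
    unfolding norm_divide norm_numeral by (intro divide_right_mono norm_triangle_ineq4) auto
  also have "\<dots> \<le> 3 / 2 * norm w ^ 3"
    using T[OF disjI1[OF refl]] T[OF disjI2[OF refl]] by simp
  finally show ?thesis .
qed

text \<open>Both \<open>sinh (c z)\<close> and \<open>sinh z\<close> are linear up to a cubic error, so their quotient is \<open>c\<close> up to
  a quadratic one.\<close>

lemma sinh_ratio_near:
  assumes c: "0 \<le> c" "c \<le> 1" and z: "3 * (norm z)\<^sup>2 \<le> 1"
  shows "\<bar>sinh_ratio c z - c\<bar> \<le> 6 * (norm z)\<^sup>2"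
proof (cases "z = 0")
  case False
  define r where "r = norm z"
  have r: "0 < r" "3 * r\<^sup>2 \<le> 1" using False z by (auto simp: r_def)
  have "r\<^sup>2 \<le> 1\<^sup>2" using r by simp
  then have r1: "r \<le> 1" by (rule power2_le_imp_le) simp
  have c': "norm (of_real c * z) = c * r" using c by (simp add: norm_mult r_def)
  have cr: "c * r \<le> r" using c r by (simp add: mult_left_le_one_le)
  have "norm (sinh (of_real c * z) - of_real c * z) \<le> 3 / 2 * (c * r) ^ 3"
    using sinh_near_identity[of "of_real c * z"] c' cr r1 by simp
  also have "\<dots> \<le> 3 / 2 * r ^ 3" using cr c r by (intro mult_left_mono power_mono) auto
  finally have 1: "norm (sinh (of_real c * z) - of_real c * z) \<le> 3 / 2 * r ^ 3" .
  have 2: "norm (sinh z - z) \<le> 3 / 2 * r ^ 3" using sinh_near_identity[of z] r1 by (simp add: r_def)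
  have 3: "norm (of_real c * (sinh z - z)) \<le> 3 / 2 * r ^ 3"
    unfolding norm_mult using c by (intro order_trans[OF mult_left_le_one_le 2]) auto
  have num: "norm (sinh (of_real c * z) - of_real c * sinh z) \<le> 3 * r ^ 3"
  proof -
    have "sinh (of_real c * z) - of_real c * sinh z
        = (sinh (of_real c * z) - of_real c * z) - of_real c * (sinh z - z)"
      by (simp add: algebra_simps)
    also have "norm \<dots> \<le> 3 / 2 * r ^ 3 + 3 / 2 * r ^ 3"
      using 1 3 by (rule order_trans[OF norm_triangle_ineq4 add_mono])
    finally show ?thesis by simp
  qed
  have "3 / 2 * r ^ 3 = 3 * r\<^sup>2 * (r / 2)" by (simp add: power2_eq_square power3_eq_cube)
  also have "\<dots> \<le> 1 * (r / 2)" using r by (intro mult_right_mono) auto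
  finally have den: "r / 2 \<le> norm (sinh z)"
    using 2 norm_triangle_ineq2[of z "sinh z"] by (simp add: norm_minus_commute r_def)
  then have nz: "sinh z \<noteq> 0" using r by auto
  have "\<bar>sinh_ratio c z - c\<bar> = \<bar>Re (sinh (of_real c * z) / sinh z - of_real c)\<bar>"
    using False by (simp add: sinh_ratio_def)
  also have "\<dots> \<le> norm (sinh (of_real c * z) / sinh z - of_real c)" by (rule abs_Re_le_cmod)
  also have "\<dots> = norm (sinh (of_real c * z) - of_real c * sinh z) / norm (sinh z)"
    using nz by (simp add: norm_divide[symmetric] diff_divide_distrib)
  also have "\<dots> \<le> 3 * r ^ 3 / (r / 2)" using num den r by (intro frac_le) auto
  also have "\<dots> = 6 * r\<^sup>2" using r by (simp add: power2_eq_square power3_eq_cube)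
  finally show ?thesis by (simp add: r_def)
qed (simp add: sinh_ratio_def)

text \<open>At coarse levels the argument of the quotient may be large; there the quadratic bound exceeds
  the assumed distance \<open>1/4\<close> and holds trivially.\<close>

lemma sinh_ratio_scaled:
  assumes c: "0 \<le> c" "c \<le> 1" and \<gamma>: "norm \<gamma> \<le> B"
    and near: "\<bar>sinh_ratio c (\<gamma> / 2 ^ k) - c\<bar> \<le> 1 / 4"
  shows "\<bar>sinh_ratio c (\<gamma> / 2 ^ k) - c\<bar> \<le> 6 * B\<^sup>2 / 4 ^ k"
proof -
  have "(norm (\<gamma> / 2 ^ k))\<^sup>2 = (norm \<gamma>)\<^sup>2 / (2 ^ k)\<^sup>2"
    by (simp add: norm_divide norm_power power_divide)
  also have "((2::real) ^ k)\<^sup>2 = 4 ^ k" by (simp add: power2_eq_square flip: power_mult_distrib)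
  also have "(norm \<gamma>)\<^sup>2 / 4 ^ k \<le> B\<^sup>2 / 4 ^ k" using \<gamma> by (intro divide_right_mono power_mono) auto
  finally have n: "(norm (\<gamma> / 2 ^ k))\<^sup>2 \<le> B\<^sup>2 / 4 ^ k" .
  show ?thesis
  proof (cases "3 * (norm (\<gamma> / 2 ^ k))\<^sup>2 \<le> 1")
    case True
    then show ?thesis using sinh_ratio_near[OF c True] n by simp
  next
    case False
    then show ?thesis using near n by simp
  qed
qed

theorem theorem4p3:
  fixes f0 :: "int \<Rightarrow> real" and eps :: "nat \<Rightarrow> int \<Rightarrow> real" and e :: real
  assumes "e > 0"
    and "\<And>k j \<nu>. \<nu> \<in> {0, 1} \<Longrightarrow> \<bar>eps k (2 * j + \<nu>)\<bar> = e"
    and "\<And>k j \<nu>. \<nu> \<in> {0, 1} \<Longrightarrow> nucc_data eps f0 k (j + \<nu>) \<noteq> 0 \<Longrightarrow>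
           sgn (eps k (2 * j + \<nu>)) = sgn (nucc_data eps f0 k (j + \<nu>))"
    and "\<exists>B. \<forall>k j. \<forall>\<nu>\<in>{0, 1}. norm (nucc_gamma eps f0 k (2 * j + \<nu>)) \<le> B"
    and "\<And>k j n. n \<in> {-2, -1, 0, 1} \<Longrightarrow>
           cc_mask n - 1 / 4 < nucc_mask eps f0 k j n \<and>
           nucc_mask eps f0 k j n < cc_mask n + 1 / 4"
  shows "stable_scheme (nucc_scheme eps f0) \<and> convergent_scheme (nucc_scheme eps f0)"
proof -
  define a where "a = nucc_mask eps f0"
  obtain B where B: "norm (nucc_gamma eps f0 k (2 * j)) \<le> B"
      "norm (nucc_gamma eps f0 k (2 * j + 1)) \<le> B" for k j
    using assms(4) by (auto simp: ball_Un)
  have near: "\<bar>a k j n - cc_mask n\<bar> \<le> 1 / 4" if "n \<in> {-2, -1, 0, 1}" for k j n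
    using assms(5)[OF that, of k j] unfolding a_def by linarith
  have support: "a k j n = 0" if "n \<notin> {-2, -1, 0, 1}" for k j n
    using that by (simp add: a_def nucc_mask_def mask_of_def)
  have close: "\<bar>a k j n - cc_mask n\<bar> \<le> 6 * B\<^sup>2 / 4 ^ k" for k j n
  proof (cases "n \<in> {-2, -1, 0, 1}")
    case True
    then consider "n = -2" | "n = -1" | "n = 0" | "n = 1" by blast
    then show ?thesis
      by cases (use near[OF True, of k j] B[of k j] in
        \<open>auto simp: a_def nucc_mask_def mask_of_def cc_mask_def intro!: sinh_ratio_scaled\<close>)
  next
    case False
    then show ?thesis using support[OF False] by (simp add: cc_mask_def)
  qed
  interpret cc_perturbation a "6 * B\<^sup>2" by unfold_locales (fact support, fact close)
  have lower: "cc_mask n - 1 / 4 < a k j n" if "n \<in> {-2, -1, 0, 1}" for k j n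
    using assms(5)[OF that] by (simp add: a_def)
  have "convergent_scheme S"
  proof (rule convergent)
    show "0 \<le> a k j n" if "n \<in> {-2, -1, 0, 1}" for k j n
      using lower[OF that, of k j] that by (auto simp: cc_mask_def)
    show "1 / 2 \<le> a k j 0 + a k j (-2)" "1 / 2 \<le> a k j 1 + a k j (-1)" for k j
      using lower[of 0 k j] lower[of "-2" k j] lower[of 1 k j] lower[of "-1" k j]
      by (auto simp: cc_mask_def)
  qed
  moreover have "nucc_scheme eps f0 = S" by (simp add: fun_eq_iff nucc_scheme_def a_def)
  ultimately show ?thesis using stable by simp
qed

end
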